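(* Let $(R,S)$ be a generalized Rota-Baxter system on an $A$-bimodule $M$ over an associative algebra $A$. Then the collection of maps $\{\Theta_n\}$ defined in the context induces a morphism $\Theta_\bullet:H^\bullet(M,A)\to H^{\bullet+1}_{\mathrm{dend}}(M,M)$ from the cohomology of the generalized Rota-Baxter system $(R,S)$ to the cohomology of the corresponding dendriform algebra $(M,\prec,\succ)$, $u\prec v=u\cdot S(v)$, $u\succ v=R(u)\cdot v$, with coefficients in itself.
   Context: All vector spaces are over a field $\mathbb{K}$ of characteristic zero. A generalized Rota-Baxter system on $M$ over $A$ is a pair of linear maps $R,S:M\to A$ with $R(u)R(v)=R(R(u)\cdot v+u\cdot S(v))$ and $S(u)S(v)=S(R(u)\cdot v+u\cdot S(v))$. Cohomology of $(R,S)$. For $F=(F_1,F_2)\in\mathrm{Hom}(M^{\otimes m},A\oplus A)$ and $G=(G_1,G_2)\in\mathrm{Hom}(M^{\otimes n},A\oplus A)$, $m,n\ge 0$, $\llbracket F,G\rrbracket\in\mathrm{Hom}(M^{\otimes(m+n)},A\oplus A)$ has components, $k=1,2$, \begin{align*} \llbracket F,G\rrbracket_k(u_1,\dots,u_{m+n})=&\sum_{i=1}^m(-1)^{(i-1)n}F_k(u_1,\dots,u_{i-1},G_1(u_i,\dots,u_{i+n-1})\cdot u_{i+n},\dots,u_{m+n})\\ &-\sum_{i=1}^m(-1)^{in}F_k(u_1,\dots,u_{i-1},u_i\cdot G_2(u_{i+1},\dots,u_{i+n}),u_{i+n+1},\dots,u_{m+n})\\ &-(-1)^{mn}\Big\{\sum_{i=1}^n(-1)^{(i-1)m}G_k(u_1,\dots,u_{i-1},F_1(u_i,\dots,u_{i+m-1})\cdot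 u_{i+m},\dots,u_{m+n})\\ &\qquad-\sum_{i=1}^n(-1)^{im}G_k(u_1,\dots,u_{i-1},u_i\cdot F_2(u_{i+1},\dots,u_{i+m}),u_{i+m+1},\dots,u_{m+n})\Big\}\\ &+(-1)^{mn}\big[F_k(u_1,\dots,u_m)G_k(u_{m+1},\dots,u_{m+n})-(-1)^{mn}G_k(u_1,\dots,u_n)F_k(u_{n+1},\dots,u_{m+n})\big]. \end{align*} This is a graded Lie bracket for which $(R,S)$ is Maurer-Cartan; $H^\bullet(M,A)$ is the cohomology of $C^n(M,A)=\mathrm{Hom}(M^{\otimes n},A\oplus A)$, $n\ge 0$, with differential $d_{(R,S)}=\llbracket(R,S),\cdot\rrbracket$. Dendriform cohomology. A dendriform algebra $(D,\prec,\succ)$ satisfies $(a\prec b)\prec c=a\prec(b\prec c+b\succ c)$, $(a\succ b)\prec c=a\succ(b\prec c)$, $(a\prec b+a\succ b)\succ c=a\succ(b\succ c)$. Let $C_n=\{[1],\dots,[n]\}$ and $\mathcal{O}(n)=\mathrm{Hom}(\mathbb{K}[C_n]\otimes D^{\otimes n},D)$, $n\ge1$. For $f\in\mathcal{O}(m)$, $g\in\mathcal{O}(n)$, $1\le i\le m$, $(f\circ_i g)([r];a_1,\dots,a_{m+n-1})$ equals: $f([r];a_1,\dots,a_{i-1},g([1]+\cdots+[n];a_i,\dots,a_{i+n-1}),\dots,a_{m+n-1})$ if $1\le r\le i-1$; $f([i];a_1,\dots,a_{i-1},g([r-i+1];a_i,\dots,a_{i+n-1}),\dots,a_{m+n-1})$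 if $i\le r\le i+n-1$; $f([r-n+1];a_1,\dots,a_{i-1},g([1]+\cdots+[n];a_i,\dots,a_{i+n-1}),\dots,a_{m+n-1})$ if $i+n\le r\le m+n-1$. For $f\in\mathcal{O}(m+1)$, $g\in\mathcal{O}(n+1)$ set $\lceil f,g\rceil=\sum_{i=1}^{m+1}(-1)^{(i-1)n}f\circ_i g-(-1)^{mn}\sum_{i=1}^{n+1}(-1)^{(i-1)m}g\circ_i f$. With $\pi\in\mathcal{O}(2)$, $\pi([1];a,b)=a\prec b$, $\pi([2];a,b)=a\succ b$, the differential is $\delta_\pi(f)=(-1)^{n-1}\lceil\pi,f\rceil$ for $f\in\mathcal{O}(n)$, and $H^\bullet_{\mathrm{dend}}(D,D)$ is the cohomology of $(\mathcal{O}(n)_{n\ge1},\delta_\pi)$. The maps $\Theta_n:\mathrm{Hom}(M^{\otimes n},A\oplus A)\to\mathrm{Hom}(\mathbb{K}[C_{n+1}]\otimes M^{\otimes(n+1)},M)$ are, for $n\ge1$: $\Theta_n(P,Q)([1];u_1,\dots,u_{n+1})=(-1)^{n+1}u_1\cdot Q(u_2,\dots,u_{n+1})$; $\Theta_n(P,Q)([r];u_1,\dots,u_{n+1})=0$ for $2\le r\le n$; $\Theta_n(P,Q)([n+1];u_1,\dots,u_{n+1})=P(u_1,\dots,u_n)\cdot u_{n+1}$. For $n=0$: $\Theta_0(a,b)([1];u)=a\cdot u-u\cdot b$. *)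

theory Defs
  imports Complex_Main "HOL-Library.Function_Algebras" "HOL-Library.Product_Plus"
begin

section \<open>Algebras, bimodules and generalized Rota-Baxter systems\<close>

text \<open>
  The multiplication of the associative algebra is that of the type class \<^class>\<open>ring\<close>,
  which does not require a unit; the ground field acts by \<open>sA\<close>.
\<close>

locale associative_algebra = vector_space sA
  for sA :: "'k::field_char_0 \<Rightarrow> 'a::ring \<Rightarrow> 'a" +
  assumes scale_mult_left: "sA c (x * y) = sA c x * y"
    and scale_mult_right: "sA c (x * y) = x * sA c y"

text \<open>\<open>l a u\<close> is the left action $a \cdot u$ and \<open>r u a\<close> is the right action $u \cdot a$.\<close>

locale bimodule = associative_algebra sA + M: vector_space sM
  for sA :: "'k::field_char_0 \<Rightarrow> 'a::ring \<Rightarrow> 'a"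
    and sM :: "'k \<Rightarrow> 'm::ab_group_add \<Rightarrow> 'm"
    and l :: "'a \<Rightarrow> 'm \<Rightarrow> 'm"
    and r :: "'m \<Rightarrow> 'a \<Rightarrow> 'm" +
  assumes left_linear_algebra: "Vector_Spaces.linear sA sM (\<lambda>a. l a u)"
    and left_linear_module: "Vector_Spaces.linear sM sM (\<lambda>u. l a u)"
    and right_linear_algebra: "Vector_Spaces.linear sA sM (\<lambda>a. r u a)"
    and right_linear_module: "Vector_Spaces.linear sM sM (\<lambda>u. r u a)"
    and left_action: "l (a * b) u = l a (l b u)"
    and right_action: "r u (a * b) = r (r u a) b"
    and actions_commute: "r (l a u) b = l a (r u b)"

locale generalized_rota_baxter_system = bimodule sA sM l r
  for sA :: "'k::field_char_0 \<Rightarrow> 'a::ring \<Rightarrow> 'a"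
    and sM :: "'k \<Rightarrow> 'm::ab_group_add \<Rightarrow> 'm"
    and l :: "'a \<Rightarrow> 'm \<Rightarrow> 'm"
    and r :: "'m \<Rightarrow> 'a \<Rightarrow> 'm" +
  fixes R S :: "'m \<Rightarrow> 'a"
  assumes linear_R: "Vector_Spaces.linear sM sA R"
    and linear_S: "Vector_Spaces.linear sM sA S"
    and R_mult: "R u * R v = R (l (R u) v + r u (S v))"
    and S_mult: "S u * S v = S (l (R u) v + r u (S v))"

locale dendriform_algebra = vector_space sD
  for sD :: "'k::field_char_0 \<Rightarrow> 'd::ab_group_add \<Rightarrow> 'd" +
  fixes prec :: "'d \<Rightarrow> 'd \<Rightarrow> 'd" and succ :: "'d \<Rightarrow> 'd \<Rightarrow> 'd"
  assumes prec_linear_left: "Vector_Spaces.linear sD sD (\<lambda>a. prec a b)"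
    and prec_linear_right: "Vector_Spaces.linear sD sD (\<lambda>b. prec a b)"
    and succ_linear_left: "Vector_Spaces.linear sD sD (\<lambda>a. succ a b)"
    and succ_linear_right: "Vector_Spaces.linear sD sD (\<lambda>b. succ a b)"
    and prec_prec: "prec (prec a b) c = prec a (prec b c + succ b c)"
    and succ_prec: "prec (succ a b) c = succ a (prec b c)"
    and succ_succ: "succ (prec a b + succ a b) c = succ a (succ b c)"

definition gRB_prec :: "('m \<Rightarrow> 'a \<Rightarrow> 'm) \<Rightarrow> ('m \<Rightarrow> 'a) \<Rightarrow> 'm \<Rightarrow> 'm \<Rightarrow> 'm" where
  "gRB_prec r S u v = r u (S v)"

definition gRB_succ :: "('a \<Rightarrow> 'm \<Rightarrow> 'm) \<Rightarrow> ('m \<Rightarrow> 'a) \<Rightarrow> 'm \<Rightarrow> 'm \<Rightarrow> 'm" where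
  "gRB_succ l R u v = l (R u) v"

lemma (in generalized_rota_baxter_system) dendriform_algebra_gRB:
  "dendriform_algebra sM (gRB_prec r S) (gRB_succ l R)"
proof (intro dendriform_algebra.intro dendriform_algebra_axioms.intro)
  show "vector_space sM" by (rule M.vector_space_axioms)
next
  fix a b c :: 'm
  show "Vector_Spaces.linear sM sM (\<lambda>a. gRB_prec r S a b)"
    unfolding gRB_prec_def by (rule right_linear_module)
  show "Vector_Spaces.linear sM sM (\<lambda>b. gRB_prec r S a b)"
    using Vector_Spaces.linear_compose[OF linear_S right_linear_algebra[of a]]
    unfolding gRB_prec_def comp_def .
  show "Vector_Spaces.linear sM sM (\<lambda>a. gRB_succ l R a b)"
    using Vector_Spaces.linear_compose[OF linear_R left_linear_algebra[of b]]
    unfolding gRB_succ_def comp_def .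
  show "Vector_Spaces.linear sM sM (\<lambda>b. gRB_succ l R a b)"
    unfolding gRB_succ_def by (rule left_linear_module)
  show "gRB_prec r S (gRB_prec r S a b) c
      = gRB_prec r S a (gRB_prec r S b c + gRB_succ l R b c)"
    unfolding gRB_prec_def gRB_succ_def right_action[symmetric]
    by (subst S_mult) (simp only: add.commute)
  show "gRB_prec r S (gRB_succ l R a b) c = gRB_succ l R a (gRB_prec r S b c)"
    unfolding gRB_prec_def gRB_succ_def by (rule actions_commute)
  show "gRB_succ l R (gRB_prec r S a b + gRB_succ l R a b) c
      = gRB_succ l R a (gRB_succ l R b c)"
    unfolding gRB_prec_def gRB_succ_def left_action[symmetric]
    by (subst R_mult) (simp only: add.commute)
qed


section \<open>Multilinear maps\<close>

text \<open>
  $\mathrm{Hom}(V^{\otimes n}, W)$ is identified with the space of \<open>n\<close>-linear maps; an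
  \<open>n\<close>-linear map takes the list of its \<open>n\<close> arguments and is zero on all other lists,
  so that maps are equal iff they agree on lists of length \<open>n\<close>.
\<close>

definition multilinear_maps ::
  "('k::field \<Rightarrow> 'v::ab_group_add \<Rightarrow> 'v) \<Rightarrow> ('k \<Rightarrow> 'w::ab_group_add \<Rightarrow> 'w) \<Rightarrow> nat
    \<Rightarrow> ('v list \<Rightarrow> 'w) set" where
  "multilinear_maps sV sW n =
    {f. (\<forall>xs ys. length xs + 1 + length ys = n \<longrightarrow>
            Vector_Spaces.linear sV sW (\<lambda>x. f (xs @ [x] @ ys)))
      \<and> (\<forall>us. length us \<noteq> n \<longrightarrow> f us = 0)}"

text \<open>
  Arguments are numbered from 1: \<open>arg u i\<close> is $u_i$, and \<open>seg u i j\<close> is the sequence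
  $u_i, \dots, u_j$, which is empty for $j < i$.
\<close>

definition arg :: "'v list \<Rightarrow> nat \<Rightarrow> 'v" where
  "arg u i = u ! (i - 1)"

definition seg :: "'v list \<Rightarrow> nat \<Rightarrow> nat \<Rightarrow> 'v list" where
  "seg u i j = take (Suc j - i) (drop (i - 1) u)"


section \<open>Cochain complexes and their cohomology\<close>

text \<open>
  A complex lives in degrees \<open>\<ge> start\<close>. Cochains of all degrees are elements of one ambient
  type, on which \<open>scalar\<close> is the action of the ground field.
\<close>

record ('k, 'c) complex =
  start :: nat
  cochains :: "nat \<Rightarrow> 'c set"
  scalar :: "'k \<Rightarrow> 'c \<Rightarrow> 'c"
  differential :: "nat \<Rightarrow> 'c \<Rightarrow> 'c"

definition cocycles :: "('k, 'c::ab_group_add) complex \<Rightarrow> nat \<Rightarrow> 'c set" where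
  "cocycles K n = {f \<in> cochains K n. differential K n f = 0}"

definition coboundaries :: "('k, 'c::ab_group_add) complex \<Rightarrow> nat \<Rightarrow> 'c set" where
  "coboundaries K n =
    (if n \<le> start K then {0} else differential K (n - 1) ` cochains K (n - 1))"

definition cohomology_class :: "('k, 'c::ab_group_add) complex \<Rightarrow> nat \<Rightarrow> 'c \<Rightarrow> 'c set" where
  "cohomology_class K n f = {f + b | b. b \<in> coboundaries K n}"

definition cohomology :: "('k, 'c::ab_group_add) complex \<Rightarrow> nat \<Rightarrow> 'c set set" where
  "cohomology K n = cohomology_class K n ` cocycles K n"

definition class_add :: "'c::ab_group_add set \<Rightarrow> 'c set \<Rightarrow> 'c set" where
  "class_add X Y = {x + y | x y. x \<in> X \<and> y \<in> Y}"

text \<open>Adding the coboundaries makes \<open>0 \<cdot> X\<close> the zero class rather than the set \<open>{0}\<close>.\<close>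

definition class_scale ::
  "('k, 'c::ab_group_add) complex \<Rightarrow> nat \<Rightarrow> 'k \<Rightarrow> 'c set \<Rightarrow> 'c set" where
  "class_scale K n c X = {scalar K c x + b | x b. x \<in> X \<and> b \<in> coboundaries K n}"

definition linear_on_cohomology ::
  "('k, 'c::ab_group_add) complex \<Rightarrow> nat \<Rightarrow> ('k, 'e::ab_group_add) complex \<Rightarrow> nat
    \<Rightarrow> ('c set \<Rightarrow> 'e set) \<Rightarrow> bool" where
  "linear_on_cohomology K n L p T \<longleftrightarrow>
    (\<forall>X \<in> cohomology K n. T X \<in> cohomology L p)
    \<and> (\<forall>X \<in> cohomology K n. \<forall>Y \<in> cohomology K n.
          T (class_add X Y) = class_add (T X) (T Y))
    \<and> (\<forall>c. \<forall>X \<in> cohomology K n. T (class_scale K n c X) = class_scale L p c (T X))"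


section \<open>The complex of a generalized Rota-Baxter system\<close>

definition scale_pair :: "('k \<Rightarrow> 'a \<Rightarrow> 'a) \<Rightarrow> 'k \<Rightarrow> 'a \<times> 'a \<Rightarrow> 'a \<times> 'a" where
  "scale_pair sA c p = (sA c (fst p), sA c (snd p))"

text \<open>
  The component of the bracket of an \<open>m\<close>-cochain and an \<open>n\<close>-cochain that is selected
  by the projection \<open>k\<close> (either \<^const>\<open>fst\<close> or \<^const>\<open>snd\<close>).
\<close>

definition bracket_component ::
  "('k::field_char_0 \<Rightarrow> 'a::ring \<Rightarrow> 'a) \<Rightarrow> ('a \<Rightarrow> 'm \<Rightarrow> 'm) \<Rightarrow> ('m \<Rightarrow> 'a \<Rightarrow> 'm)
    \<Rightarrow> nat \<Rightarrow> nat \<Rightarrow> ('a \<times> 'a \<Rightarrow> 'a) \<Rightarrow> ('m list \<Rightarrow> 'a \<times> 'a) \<Rightarrow> ('m list \<Rightarrow> 'a \<times> 'a)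
    \<Rightarrow> 'm list \<Rightarrow> 'a" where
  "bracket_component sA l r m n k F G u =
    (\<Sum>i = 1..m. sA ((-1) ^ ((i - 1) * n))
        (k (F (seg u 1 (i - 1) @ [l (fst (G (seg u i (i + n - 1)))) (arg u (i + n))]
              @ seg u (i + n + 1) (m + n)))))
    - (\<Sum>i = 1..m. sA ((-1) ^ (i * n))
        (k (F (seg u 1 (i - 1) @ [r (arg u i) (snd (G (seg u (i + 1) (i + n))))]
              @ seg u (i + n + 1) (m + n)))))
    - sA ((-1) ^ (m * n))
       ((\<Sum>i = 1..n. sA ((-1) ^ ((i - 1) * m))
          (k (G (seg u 1 (i - 1) @ [l (fst (F (seg u i (i + m - 1)))) (arg u (i + m))]
                @ seg u (i + m + 1) (m + n)))))
        - (\<Sum>i = 1..n. sA ((-1) ^ (i * m))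
          (k (G (seg u 1 (i - 1) @ [r (arg u i) (snd (F (seg u (i + 1) (i + m))))]
                @ seg u (i + m + 1) (m + n))))))
    + sA ((-1) ^ (m * n))
       (k (F (seg u 1 m)) * k (G (seg u (m + 1) (m + n)))
        - sA ((-1) ^ (m * n)) (k (G (seg u 1 n)) * k (F (seg u (n + 1) (m + n)))))"

definition gRB_bracket ::
  "('k::field_char_0 \<Rightarrow> 'a::ring \<Rightarrow> 'a) \<Rightarrow> ('a \<Rightarrow> 'm \<Rightarrow> 'm) \<Rightarrow> ('m \<Rightarrow> 'a \<Rightarrow> 'm)
    \<Rightarrow> nat \<Rightarrow> nat \<Rightarrow> ('m list \<Rightarrow> 'a \<times> 'a) \<Rightarrow> ('m list \<Rightarrow> 'a \<times> 'a) \<Rightarrow> 'm list \<Rightarrow> 'a \<times> 'a" where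
  "gRB_bracket sA l r m n F G u =
    (if length u = m + n
     then (bracket_component sA l r m n fst F G u, bracket_component sA l r m n snd F G u)
     else 0)"

definition gRB_element :: "('m \<Rightarrow> 'a::ring) \<Rightarrow> ('m \<Rightarrow> 'a) \<Rightarrow> 'm list \<Rightarrow> 'a \<times> 'a" where
  "gRB_element R S u = (if length u = 1 then (R (arg u 1), S (arg u 1)) else 0)"

definition gRB_complex ::
  "('k::field_char_0 \<Rightarrow> 'a::ring \<Rightarrow> 'a) \<Rightarrow> ('k \<Rightarrow> 'm::ab_group_add \<Rightarrow> 'm)
    \<Rightarrow> ('a \<Rightarrow> 'm \<Rightarrow> 'm) \<Rightarrow> ('m \<Rightarrow> 'a \<Rightarrow> 'm) \<Rightarrow> ('m \<Rightarrow> 'a) \<Rightarrow> ('m \<Rightarrow> 'a)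
    \<Rightarrow> ('k, 'm list \<Rightarrow> 'a \<times> 'a) complex" where
  "gRB_complex sA sM l r R S =
    \<lparr> start = 0,
      cochains = multilinear_maps sM (scale_pair sA),
      scalar = (\<lambda>c F u. scale_pair sA c (F u)),
      differential = (\<lambda>n. gRB_bracket sA l r 1 n (gRB_element R S)) \<rparr>"


section \<open>The complex of a dendriform algebra\<close>

text \<open>
  A linear map on $\mathbb{K}[C_n] \otimes D^{\otimes n}$ is given by its values \<open>f s u\<close> at
  the basis elements $[s]$ of $\mathbb{K}[C_n]$; it is zero for \<open>s\<close> outside $\{1,\dots,n\}$.
\<close>

definition dend_cochains ::
  "('k::field_char_0 \<Rightarrow> 'd::ab_group_add \<Rightarrow> 'd) \<Rightarrow> nat \<Rightarrow> (nat \<Rightarrow> 'd list \<Rightarrow> 'd) set" where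
  "dend_cochains sD n =
    {f. (\<forall>s \<in> {1..n}. f s \<in> multilinear_maps sD sD n) \<and> (\<forall>s. s \<notin> {1..n} \<longrightarrow> f s = 0)}"

definition dend_comp ::
  "nat \<Rightarrow> nat \<Rightarrow> (nat \<Rightarrow> 'd list \<Rightarrow> 'd) \<Rightarrow> nat \<Rightarrow> (nat \<Rightarrow> 'd list \<Rightarrow> 'd)
    \<Rightarrow> nat \<Rightarrow> 'd list \<Rightarrow> 'd::ab_group_add" where
  "dend_comp m n f i g s a =
    (if length a \<noteq> m + n - 1 then 0
     else if 1 \<le> s \<and> s \<le> i - 1 then
       f s (seg a 1 (i - 1) @ [\<Sum>t = 1..n. g t (seg a i (i + n - 1))] @ seg a (i + n) (m + n - 1))
     else if i \<le> s \<and> s \<le> i + n - 1 then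
       f i (seg a 1 (i - 1) @ [g (s - i + 1) (seg a i (i + n - 1))] @ seg a (i + n) (m + n - 1))
     else if i + n \<le> s \<and> s \<le> m + n - 1 then
       f (s - n + 1)
         (seg a 1 (i - 1) @ [\<Sum>t = 1..n. g t (seg a i (i + n - 1))] @ seg a (i + n) (m + n - 1))
     else 0)"

text \<open>Here \<open>f\<close> has arity \<open>m + 1\<close> and \<open>g\<close> has arity \<open>n + 1\<close>.\<close>

definition dend_bracket ::
  "('k::field_char_0 \<Rightarrow> 'd::ab_group_add \<Rightarrow> 'd) \<Rightarrow> nat \<Rightarrow> nat
    \<Rightarrow> (nat \<Rightarrow> 'd list \<Rightarrow> 'd) \<Rightarrow> (nat \<Rightarrow> 'd list \<Rightarrow> 'd) \<Rightarrow> nat \<Rightarrow> 'd list \<Rightarrow> 'd" where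
  "dend_bracket sD m n f g s a =
    (\<Sum>i = 1..m + 1. sD ((-1) ^ ((i - 1) * n)) (dend_comp (m + 1) (n + 1) f i g s a))
    - sD ((-1) ^ (m * n))
       (\<Sum>i = 1..n + 1. sD ((-1) ^ ((i - 1) * m)) (dend_comp (n + 1) (m + 1) g i f s a))"

definition dend_element ::
  "('d \<Rightarrow> 'd \<Rightarrow> 'd) \<Rightarrow> ('d \<Rightarrow> 'd \<Rightarrow> 'd) \<Rightarrow> nat \<Rightarrow> 'd list \<Rightarrow> 'd::ab_group_add" where
  "dend_element prec succ s a =
    (if length a \<noteq> 2 then 0
     else if s = 1 then prec (arg a 1) (arg a 2)
     else if s = 2 then succ (arg a 1) (arg a 2)
     else 0)"

definition dend_complex ::
  "('k::field_char_0 \<Rightarrow> 'd::ab_group_add \<Rightarrow> 'd) \<Rightarrow> ('d \<Rightarrow> 'd \<Rightarrow> 'd) \<Rightarrow> ('d \<Rightarrow> 'd \<Rightarrow> 'd)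
    \<Rightarrow> ('k, nat \<Rightarrow> 'd list \<Rightarrow> 'd) complex" where
  "dend_complex sD prec succ =
    \<lparr> start = 1,
      cochains = dend_cochains sD,
      scalar = (\<lambda>c f s a. sD c (f s a)),
      differential =
        (\<lambda>n f s a. sD ((-1) ^ (n - 1))
           (dend_bracket sD 1 (n - 1) (dend_element prec succ) f s a)) \<rparr>"


section \<open>The comparison maps\<close>

definition Theta ::
  "('k::field_char_0 \<Rightarrow> 'm::ab_group_add \<Rightarrow> 'm) \<Rightarrow> ('a \<Rightarrow> 'm \<Rightarrow> 'm) \<Rightarrow> ('m \<Rightarrow> 'a \<Rightarrow> 'm)
    \<Rightarrow> nat \<Rightarrow> ('m list \<Rightarrow> 'a \<times> 'a) \<Rightarrow> nat \<Rightarrow> 'm list \<Rightarrow> 'm" where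
  "Theta sM l r n F s u =
    (if length u \<noteq> n + 1 then 0
     else if n = 0 then
       (if s = 1 then l (fst (F [])) (arg u 1) - r (arg u 1) (snd (F [])) else 0)
     else if s = 1 then sM ((-1) ^ (n + 1)) (r (arg u 1) (snd (F (seg u 2 (n + 1)))))
     else if s = n + 1 then l (fst (F (seg u 1 n))) (arg u (n + 1))
     else 0)"

end

theory Submission
  imports Defs
begin

text \<open>
  The maps $\Theta_n$ commute with the differentials up to sign,
  $\Theta_{n+1}(d_{(R,S)} F) = (-1)^n\, \delta_\pi(\Theta_n F)$, so they preserve cocycles and
  coboundaries. At $[1]$ and $[n+2]$ the two sides agree term by term, because the terms
  $R(\cdot)$ and $S(\cdot)$ of $d_{(R,S)} F$ contain exactly the sum over $[1],\dots,[n+1]$ of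
  $\Theta_n F$. At the remaining $[s]$ the left side is zero; on the right at most two pairs
  of terms survive, one for $s = 2$ and one for $s = n+1$, and each cancels by the bimodule
  axiom $(a \cdot u) \cdot b = a \cdot (u \cdot b)$. Passing to cohomology does not use that the
  differentials square to zero.
\<close>

section \<open>Maps induced on cohomology\<close>

locale linear_complex = vector_space "scalar K"
  for K :: "('k::field, 'c::ab_group_add) complex" +
  assumes subspace_cochains: "subspace (cochains K n)"
    and differential_add: "\<lbrakk>f \<in> cochains K n; g \<in> cochains K n\<rbrakk>
      \<Longrightarrow> differential K n (f + g) = differential K n f + differential K n g"
    and differential_scale: "f \<in> cochains K n
      \<Longrightarrow> differential K n (scalar K c f) = scalar K c (differential K n f)"
begin

lemma differential_zero: "differential K n 0 = 0"
  using differential_scale[of 0 n 0] subspace_0[OF subspace_cochains[of n]] by simp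

lemma subspace_cocycles: "subspace (cocycles K n)"
  unfolding cocycles_def
  using subspace_cochains[of n]
  by (auto simp: subspace_def differential_add differential_scale differential_zero)

lemma subspace_coboundaries: "subspace (coboundaries K n)"
proof (cases "n \<le> start K")
  case True
  then show ?thesis by (simp add: coboundaries_def subspace_def)
next
  case False
  have sub: "subspace (cochains K (n - 1))" by (rule subspace_cochains)
  have B: "coboundaries K n = differential K (n - 1) ` cochains K (n - 1)"
    using False by (simp add: coboundaries_def)
  show ?thesis unfolding B
  proof (rule subspaceI)
    show "0 \<in> differential K (n - 1) ` cochains K (n - 1)"
      using differential_zero subspace_0[OF sub] by force
  next
    fix x y
    assume "x \<in> differential K (n - 1) ` cochains K (n - 1)"
      and "y \<in> differential K (n - 1) ` cochains K (n - 1)"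
    then show "x + y \<in> differential K (n - 1) ` cochains K (n - 1)"
      using subspace_add[OF sub] by (auto simp: differential_add[symmetric])
  next
    fix c x
    assume "x \<in> differential K (n - 1) ` cochains K (n - 1)"
    then show "scalar K c x \<in> differential K (n - 1) ` cochains K (n - 1)"
      using subspace_scale[OF sub] by (auto simp: differential_scale[symmetric])
  qed
qed

lemma mem_cohomology_class_iff: "x \<in> cohomology_class K n f \<longleftrightarrow> x - f \<in> coboundaries K n"
  unfolding cohomology_class_def by (auto intro: exI[of _ "x - f"])

lemma cohomology_class_eq_iff:
  "cohomology_class K n f = cohomology_class K n g \<longleftrightarrow> f - g \<in> coboundaries K n"
proof
  assume "cohomology_class K n f = cohomology_class K n g"
  then have "f \<in> cohomology_class K n g"
    using mem_cohomology_class_iff[of f n f] subspace_0[OF subspace_coboundaries] by simp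
  then show "f - g \<in> coboundaries K n" by (simp add: mem_cohomology_class_iff)
next
  assume fg: "f - g \<in> coboundaries K n"
  have "x - f \<in> coboundaries K n \<longleftrightarrow> x - g \<in> coboundaries K n" for x
    using subspace_add[OF subspace_coboundaries fg, of "x - f"]
      subspace_diff[OF subspace_coboundaries _ fg, of "x - g"] by auto
  then show "cohomology_class K n f = cohomology_class K n g"
    by (auto simp: mem_cohomology_class_iff)
qed

lemma class_add_cohomology_class:
  "class_add (cohomology_class K n f) (cohomology_class K n g) = cohomology_class K n (f + g)"
proof (intro set_eqI iffI)
  fix x
  assume "x \<in> class_add (cohomology_class K n f) (cohomology_class K n g)"
  then obtain y z where "x = y + z" "y - f \<in> coboundaries K n" "z - g \<in> coboundaries K n"
    by (auto simp: class_add_def mem_cohomology_class_iff)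
  then show "x \<in> cohomology_class K n (f + g)"
    using subspace_add[OF subspace_coboundaries, of "y - f" n "z - g"]
    by (simp add: mem_cohomology_class_iff algebra_simps)
next
  fix x
  assume "x \<in> cohomology_class K n (f + g)"
  then have "x = f + (x - f) \<and> f \<in> cohomology_class K n f \<and> x - f \<in> cohomology_class K n g"
    using subspace_0[OF subspace_coboundaries]
    by (simp add: mem_cohomology_class_iff algebra_simps)
  then show "x \<in> class_add (cohomology_class K n f) (cohomology_class K n g)"
    unfolding class_add_def by blast
qed

lemma class_scale_cohomology_class:
  "class_scale K n c (cohomology_class K n f) = cohomology_class K n (scalar K c f)"
proof (intro set_eqI iffI)
  fix x
  assume "x \<in> class_scale K n c (cohomology_class K n f)"
  then obtain y b where x: "x = scalar K c y + b"
    and y: "y - f \<in> coboundaries K n" and b: "b \<in> coboundaries K n"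
    by (auto simp: class_scale_def mem_cohomology_class_iff)
  have "scalar K c (y - f) + b \<in> coboundaries K n"
    by (intro subspace_add subspace_scale subspace_coboundaries y b)
  then show "x \<in> cohomology_class K n (scalar K c f)"
    by (simp add: x mem_cohomology_class_iff scale_right_diff_distrib algebra_simps)
next
  fix x
  assume "x \<in> cohomology_class K n (scalar K c f)"
  then have "x = scalar K c f + (x - scalar K c f) \<and> f \<in> cohomology_class K n f
      \<and> x - scalar K c f \<in> coboundaries K n"
    using subspace_0[OF subspace_coboundaries] by (simp add: mem_cohomology_class_iff)
  then show "x \<in> class_scale K n c (cohomology_class K n f)"
    unfolding class_scale_def by blast
qed

end

lemma induced_map_on_cohomology:
  fixes K :: "('k::field, 'c::ab_group_add) complex" and L :: "('k, 'e::ab_group_add) complex"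
    and \<Phi> :: "nat \<Rightarrow> 'c \<Rightarrow> 'e"
  assumes K: "linear_complex K" and L: "linear_complex L"
    and start: "start L = start K + 1"
    and cochain: "\<And>n f. f \<in> cochains K n \<Longrightarrow> \<Phi> n f \<in> cochains L (n + 1)"
    and add: "\<And>n f g. \<Phi> n (f + g) = \<Phi> n f + \<Phi> n g"
    and scale: "\<And>n c f. \<Phi> n (scalar K c f) = scalar L c (\<Phi> n f)"
    and commute: "\<And>n f. f \<in> cochains K n \<Longrightarrow>
      \<Phi> (n + 1) (differential K n f) = scalar L ((-1) ^ n) (differential L (n + 1) (\<Phi> n f))"
  shows "\<exists>T. \<forall>n. linear_on_cohomology K n L (n + 1) (T n)
      \<and> (\<forall>f \<in> cocycles K n. \<Phi> n f \<in> cocycles L (n + 1)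
            \<and> T n (cohomology_class K n f) = cohomology_class L (n + 1) (\<Phi> n f))
      \<and> (\<forall>f \<in> coboundaries K n. \<Phi> n f \<in> coboundaries L (n + 1))"
proof -
  interpret K: linear_complex K by fact
  interpret L: linear_complex L by fact
  have zero: "\<Phi> n 0 = 0" for n using add[of n 0 0] by simp
  have diff: "\<Phi> n (f - g) = \<Phi> n f - \<Phi> n g" for n f g
    using add[of n "f - g" g] by simp
  have cocycle: "\<Phi> n f \<in> cocycles L (n + 1)" if "f \<in> cocycles K n" for n f
  proof -
    have "scalar L ((-1) ^ n) (differential L (n + 1) (\<Phi> n f)) = 0"
      using that commute[of f n] by (simp add: cocycles_def zero)
    then show ?thesis using that cochain[of f n] by (simp add: cocycles_def)
  qed
  have coboundary: "\<Phi> n f \<in> coboundaries L (n + 1)" if f: "f \<in> coboundaries K n" for n f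
  proof (cases "n \<le> start K")
    case True
    then show ?thesis
      using f zero L.subspace_0[OF L.subspace_coboundaries] by (simp add: coboundaries_def)
  next
    case False
    then obtain p where n: "n = p + 1" by (cases n) auto
    then obtain g where g: "g \<in> cochains K p" "f = differential K p g"
      using f False by (auto simp: coboundaries_def)
    have "differential L (p + 1) (\<Phi> p g) \<in> coboundaries L (n + 1)"
      using False cochain[OF g(1)] by (simp add: coboundaries_def n start)
    then show ?thesis
      using commute[OF g(1)] L.subspace_scale[OF L.subspace_coboundaries]
      by (simp add: g(2) n)
  qed
  define T where "T n X = cohomology_class L (n + 1)
      (\<Phi> n (SOME f. f \<in> cocycles K n \<and> X = cohomology_class K n f))" for n X
  have T: "T n (cohomology_class K n f) = cohomology_class L (n + 1) (\<Phi> n f)"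
    if "f \<in> cocycles K n" for n f
  proof -
    define g where "g = (SOME g. g \<in> cocycles K n \<and> cohomology_class K n f = cohomology_class K n g)"
    have "cohomology_class K n f = cohomology_class K n g"
      unfolding g_def
      using someI[of "\<lambda>g. g \<in> cocycles K n \<and> cohomology_class K n f = cohomology_class K n g" f] that
      by auto
    then have "\<Phi> n f - \<Phi> n g \<in> coboundaries L (n + 1)"
      using coboundary[of "f - g" n] by (simp add: K.cohomology_class_eq_iff diff)
    then show ?thesis
      unfolding T_def g_def[symmetric] by (simp only: L.cohomology_class_eq_iff[symmetric])
  qed
  have "linear_on_cohomology K n L (n + 1) (T n)" for n
    using K.subspace_add[OF K.subspace_cocycles[of n]]
      K.subspace_scale[OF K.subspace_cocycles[of n]]
    by (auto simp: linear_on_cohomology_def cohomology_def T cocycle[simplified]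
        K.class_add_cohomology_class L.class_add_cohomology_class
        K.class_scale_cohomology_class L.class_scale_cohomology_class add scale)
  then show ?thesis using cocycle coboundary T by blast
qed


section \<open>Multilinear maps\<close>

lemma multilinear_maps_add:
  assumes "f \<in> multilinear_maps sV sW n" "length xs + 1 + length ys = n"
  shows "f (xs @ (x + y) # ys) = f (xs @ x # ys) + f (xs @ y # ys)"
  using assms by (auto simp: multilinear_maps_def Vector_Spaces.linear_iff)

lemma subspace_multilinear_maps:
  assumes "vector_space sV" "vector_space sW"
  shows "0 \<in> multilinear_maps sV sW n"
    and "f \<in> multilinear_maps sV sW n \<Longrightarrow> g \<in> multilinear_maps sV sW n
      \<Longrightarrow> f + g \<in> multilinear_maps sV sW n"
    and "f \<in> multilinear_maps sV sW n \<Longrightarrow> (\<lambda>u. sW c (f u)) \<in> multilinear_maps sV sW n"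
proof -
  interpret V: vector_space sV by fact
  interpret W: vector_space sW by fact
  show "0 \<in> multilinear_maps sV sW n"
    and "f \<in> multilinear_maps sV sW n \<Longrightarrow> g \<in> multilinear_maps sV sW n
      \<Longrightarrow> f + g \<in> multilinear_maps sV sW n"
    and "f \<in> multilinear_maps sV sW n \<Longrightarrow> (\<lambda>u. sW c (f u)) \<in> multilinear_maps sV sW n"
    using assms
    by (auto simp: multilinear_maps_def Vector_Spaces.linear_iff W.scale_right_distrib
        W.scale_left_commute)
qed

lemma seg_Suc: "seg u (Suc i) j = take (j - i) (drop i u)"
  by (simp add: seg_def)

lemma arg_Suc: "arg u (Suc i) = u ! i"
  by (simp add: arg_def)

text \<open>In contrast to \<^const>\<open>arg\<close> and \<^const>\<open>seg\<close>, the position is counted from 0.\<close>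

definition contract :: "('v \<Rightarrow> 'v \<Rightarrow> 'v) \<Rightarrow> nat \<Rightarrow> 'v list \<Rightarrow> 'v list" where
  "contract p i u = take i u @ p (u ! i) (u ! Suc i) # drop (Suc (Suc i)) u"

lemma length_contract: "Suc i < length u \<Longrightarrow> length (contract p i u) = length u - 1"
  by (simp add: contract_def)

lemma contract_Suc_Cons: "contract p (Suc i) (x # u) = x # contract p i u"
  by (simp add: contract_def)

lemma contract_snoc: "Suc i < length u \<Longrightarrow> contract p i (u @ [x]) = contract p i u @ [x]"
  by (simp add: contract_def nth_append)


section \<open>The two differentials\<close>

lemma vector_space_scale_pair:
  assumes "vector_space sA"
  shows "vector_space (scale_pair sA)"
proof -
  interpret vector_space sA by fact
  show ?thesis
    by unfold_locales
      (auto simp: scale_pair_def scale_right_distrib scale_left_distrib prod_eq_iff)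
qed

context generalized_rota_baxter_system
begin

interpretation la: Vector_Spaces.linear sA sM "\<lambda>a. l a u" for u by (rule left_linear_algebra)
interpretation lm: Vector_Spaces.linear sM sM "\<lambda>u. l a u" for a by (rule left_linear_module)
interpretation ra: Vector_Spaces.linear sA sM "\<lambda>a. r u a" for u by (rule right_linear_algebra)
interpretation rm: Vector_Spaces.linear sM sM "\<lambda>u. r u a" for a by (rule right_linear_module)
interpretation R: Vector_Spaces.linear sM sA R by (rule linear_R)
interpretation S: Vector_Spaces.linear sM sA S by (rule linear_S)

abbreviation pr where "pr \<equiv> gRB_prec r S"
abbreviation su where "su \<equiv> gRB_succ l R"
abbreviation star where "star u v \<equiv> pr u v + su u v"

lemma gRB_differential:
  assumes F: "F \<in> multilinear_maps sM (scale_pair sA) n" and u: "length u = Suc n"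
    and k: "k = fst \<and> Q = R \<or> k = snd \<and> Q = S"
  shows "k (differential (gRB_complex sA sM l r R S) n F u) =
    Q (l (fst (F (take n u))) (u ! n))
    - sA ((-1) ^ n) (Q (r (u ! 0) (snd (F (drop 1 u)))))
    - sA ((-1) ^ n) (\<Sum>i<n. sA ((-1) ^ i) (k (F (contract star i u))))
    + sA ((-1) ^ n) (Q (u ! 0) * k (F (drop 1 u)))
    - k (F (take n u)) * Q (u ! n)"
proof -
  have k_add: "k (x + y) = k x + k y" for x y using k by auto
  have k_el: "k (gRB_element R S [x]) = Q x" for x using k by (auto simp: gRB_element_def arg_def)
  have el: "gRB_element R S [x] = (R x, S x)" for x by (simp add: gRB_element_def arg_def)
  have seg1: "seg u (Suc i) (Suc i) = [u ! i]" if "i \<le> n" for i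
    using that u by (simp add: seg_Suc take_Suc hd_drop_conv_nth)
  have fin: "seg u (Suc i) (Suc n) = drop i u" for i
    using u by (simp add: seg_Suc)
  have split: "F (contract star i u) =
      F (take i u @ l (R (u ! i)) (u ! Suc i) # drop (Suc (Suc i)) u)
      + F (take i u @ r (u ! i) (S (u ! Suc i)) # drop (Suc (Suc i)) u)" if "i < n" for i
    using that u
    by (subst multilinear_maps_add[OF F, symmetric])
      (auto simp: contract_def gRB_prec_def gRB_succ_def add.commute)
  have first: "take (Suc 0) u = [u ! 0]" and last: "drop n u = [u ! n]"
    using u Cons_nth_drop_Suc[of n u] by (cases u; simp)+
  have comp: "k (differential (gRB_complex sA sM l r R S) n F u)
      = bracket_component sA l r 1 n k (gRB_element R S) F u"
    using k u by (auto simp: gRB_complex_def gRB_bracket_def)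
  have sums: "(\<Sum>i = 1..n. sA ((-1) ^ ((i - 1) * 1))
          (k (F (seg u 1 (i - 1) @ [l (fst (gRB_element R S (seg u i (i + 1 - 1)))) (arg u (i + 1))]
                @ seg u (i + 1 + 1) (1 + n)))))
        - (\<Sum>i = 1..n. sA ((-1) ^ (i * 1))
          (k (F (seg u 1 (i - 1) @ [r (arg u i) (snd (gRB_element R S (seg u (i + 1) (i + 1))))]
                @ seg u (i + 1 + 1) (1 + n)))))
      = (\<Sum>i<n. sA ((-1) ^ i) (k (F (contract star i u))))"
    unfolding sum_subtractf[symmetric] One_nat_def sum.atLeast1_atMost_eq
    by (rule sum.cong[OF refl])
      (simp add: seg1 fin el split k_add scale_right_distrib arg_Suc seg_Suc[of u 0])
  show ?thesis
    unfolding comp bracket_component_def sums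
    using u
    by (simp add: arg_Suc seg_Suc[of u 0] seg1 fin k_el first last seg_Suc[of u 1] scale_right_diff_distrib numeral_2_eq_2)
qed

text \<open>\<open>dend_term f s a i\<close> is $(f \circ_{i+1} \pi)([s]; a)$.\<close>

definition dend_term :: "(nat \<Rightarrow> 'm list \<Rightarrow> 'm) \<Rightarrow> nat \<Rightarrow> 'm list \<Rightarrow> nat \<Rightarrow> 'm" where
  "dend_term f s a i =
    (if s \<le> i then f s (contract star i a)
     else if s = Suc i then f s (contract pr i a)
     else if s = Suc (Suc i) then f (s - 1) (contract su i a)
     else f (s - 1) (contract star i a))"

lemma dend_differential:
  assumes a: "length a = Suc (Suc n)" and s: "1 \<le> s" "s \<le> Suc (Suc n)"
  shows "differential (dend_complex sM pr su) (Suc n) f s a =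
    sM ((-1) ^ n)
      (if s \<le> Suc n then r (f s (take (Suc n) a)) (S (a ! Suc n))
       else l (R (\<Sum>t = 1..Suc n. f t (take (Suc n) a))) (a ! Suc n))
    + (if s = 1 then r (a ! 0) (S (\<Sum>t = 1..Suc n. f t (drop 1 a)))
       else l (R (a ! 0)) (f (s - 1) (drop 1 a)))
    - (\<Sum>i<Suc n. sM ((-1) ^ i) (dend_term f s a i))"
proof -
  have el: "dend_element pr su (Suc 0) [x, y] = r x (S y)"
    "dend_element pr su (Suc (Suc 0)) [x, y] = l (R x) y" for x y
    by (simp_all add: dend_element_def arg_def gRB_prec_def gRB_succ_def)
  have el_sum: "(\<Sum>t = 1..2. dend_element pr su t [x, y]) = star x y" for x y
    by (simp add: numeral_2_eq_2 el gRB_prec_def gRB_succ_def)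
  have pair: "seg a (Suc i) (Suc (Suc i)) = [a ! i, a ! Suc i]" if "i \<le> n" for i
  proof -
    have "drop i a = a ! i # a ! Suc i # drop (Suc (Suc i)) a"
      using that a by (simp add: Cons_nth_drop_Suc)
    then show ?thesis by (simp add: seg_Suc)
  qed
  have last: "seg a (Suc (Suc n)) (Suc (Suc n)) = [a ! Suc n]"
    using a Cons_nth_drop_Suc[of "Suc n" a] by (simp add: seg_Suc)
  have first: "take (Suc 0) a = [a ! 0]"
    using a by (cases a) auto
  have fin: "seg a (Suc i) (Suc (Suc n)) = drop i a" for i
    using a by (simp add: seg_Suc)
  have index: "Suc (s - Suc (Suc 0)) = s - Suc 0" if "Suc (Suc 0) \<le> s"
    using that by simp
  have c1: "dend_comp 2 (Suc n) (dend_element pr su) 1 f s a =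
      (if s \<le> Suc n then r (f s (take (Suc n) a)) (S (a ! Suc n))
       else l (R (\<Sum>t = 1..Suc n. f t (take (Suc n) a))) (a ! Suc n))"
    using a s by (auto simp: dend_comp_def seg_Suc[of a 0] last el le_Suc_eq numeral_2_eq_2)
  have c2: "dend_comp 2 (Suc n) (dend_element pr su) 2 f s a =
      (if s = 1 then r (a ! 0) (S (\<Sum>t = 1..Suc n. f t (drop 1 a)))
       else l (R (a ! 0)) (f (s - 1) (drop 1 a)))"
    using a s by (auto simp: dend_comp_def seg_Suc[of a 0] fin first el numeral_2_eq_2 index)
  have c3: "dend_comp (Suc n) 2 f (Suc i) (dend_element pr su) s a = dend_term f s a i"
    if "i \<le> n" for i
    using that a s
    by (auto simp: dend_comp_def dend_term_def contract_def gRB_prec_def gRB_succ_def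
        seg_Suc[of a 0] fin pair el el_sum[unfolded gRB_prec_def gRB_succ_def] index numeral_2_eq_2 numeral_3_eq_3)
  have t1: "(\<Sum>i = 1..n + 1. sM ((-1) ^ ((i - 1) * 1))
          (dend_comp (n + 1) (1 + 1) f i (dend_element pr su) s a))
      = (\<Sum>i<Suc n. sM ((-1) ^ i) (dend_term f s a i))"
    unfolding Suc_eq_plus1[symmetric] One_nat_def sum.atLeast1_atMost_eq
    by (rule sum.cong) (use c3 in \<open>simp_all add: numeral_2_eq_2\<close>)
  have t2: "(\<Sum>i = 1..1 + 1. sM ((-1) ^ ((i - 1) * n))
          (dend_comp (1 + 1) (n + 1) (dend_element pr su) i f s a))
      = dend_comp 2 (Suc n) (dend_element pr su) 1 f s a
        + sM ((-1) ^ n) (dend_comp 2 (Suc n) (dend_element pr su) 2 f s a)"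
    by (simp add: numeral_2_eq_2)
  show ?thesis
    unfolding c1[symmetric] c2[symmetric] dend_complex_def complex.select_convs dend_bracket_def
      diff_Suc_1 t1 t2
    by (cases "even n") simp_all
qed


section \<open>The comparison maps\<close>

lemma Theta_first:
  assumes "n \<ge> 1" "length u = Suc n"
  shows "Theta sM l r n F 1 u = sM ((-1) ^ (n + 1)) (r (u ! 0) (snd (F (drop 1 u))))"
  using assms by (simp add: Theta_def arg_def seg_def)

lemma Theta_last:
  assumes "n \<ge> 1" "length u = Suc n"
  shows "Theta sM l r n F (Suc n) u = l (fst (F (take n u))) (u ! n)"
  using assms by (simp add: Theta_def arg_def seg_def)

lemma Theta_middle:
  assumes "s \<noteq> 1" "s \<noteq> Suc n"
  shows "Theta sM l r n F s u = 0"
  using assms by (simp add: Theta_def)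

lemma Theta_sum:
  assumes "n \<ge> 1" "length u = Suc n"
  shows "(\<Sum>s = 1..Suc n. Theta sM l r n F s u) =
    sM ((-1) ^ (n + 1)) (r (u ! 0) (snd (F (drop 1 u)))) + l (fst (F (take n u))) (u ! n)"
proof -
  have "(\<Sum>s = 1..Suc n. Theta sM l r n F s u) = (\<Sum>s \<in> {1, Suc n}. Theta sM l r n F s u)"
    by (rule sum.mono_neutral_right) (auto intro: Theta_middle[simplified])
  then show ?thesis
    using assms by (simp add: Theta_first[simplified] Theta_last)
qed

lemma Theta_add: "Theta sM l r n (F + G) = Theta sM l r n F + Theta sM l r n G"
  by (intro ext) (simp add: Theta_def la.add ra.add M.scale_right_distrib)

lemma Theta_scale:
  "Theta sM l r n (\<lambda>u. scale_pair sA c (F u)) = (\<lambda>s u. sM c (Theta sM l r n F s u))"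
  by (intro ext)
    (auto simp: Theta_def scale_pair_def la.scale ra.scale M.scale_left_commute
      M.scale_right_diff_distrib)

lemma Theta_cochain:
  assumes F: "F \<in> multilinear_maps sM (scale_pair sA) n"
  shows "Theta sM l r n F \<in> dend_cochains sM (n + 1)"
proof -
  have add: "F (xs @ (x + y) # ys) = F (xs @ x # ys) + F (xs @ y # ys)"
    if "length xs + 1 + length ys = n" for xs ys x y
    using F that by (rule multilinear_maps_add)
  have scale: "F (xs @ sM c x # ys) = scale_pair sA c (F (xs @ x # ys))"
    if "length xs + 1 + length ys = n" for xs ys x c
    using F that by (auto simp: multilinear_maps_def Vector_Spaces.linear_iff)
  have "Vector_Spaces.linear sM sM (\<lambda>x. Theta sM l r n F s (xs @ [x] @ ys))"
    if len: "length xs + 1 + length ys = Suc n" for s xs ys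
  proof (cases "n = 0")
    case True
    then show ?thesis
      using len
      by (auto simp: Vector_Spaces.linear_iff M.vector_space_axioms Theta_def arg_def lm.add rm.add
          lm.scale rm.scale M.scale_right_diff_distrib)
  next
    case n: False
    consider "s = 1" | "s = Suc n" "s \<noteq> 1" | "s \<noteq> 1" "s \<noteq> Suc n" by blast
    then show ?thesis
    proof cases
      case 1
      have "Theta sM l r n F s (xs @ [x] @ ys) =
          sM ((-1) ^ (n + 1)) (r ((xs @ [x] @ ys) ! 0) (snd (F (drop 1 (xs @ [x] @ ys)))))" for x
        unfolding 1 using n len by (subst Theta_first) auto
      then show ?thesis
        using len
        by (cases xs) (auto simp: Vector_Spaces.linear_iff M.vector_space_axioms
          rm.add rm.scale add scale ra.add ra.scale scale_pair_def
          M.scale_right_distrib M.scale_left_commute)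
    next
      case 2
      have eq: "Theta sM l r n F s (xs @ [x] @ ys) =
          l (fst (F (take n (xs @ [x] @ ys)))) ((xs @ [x] @ ys) ! n)" for x
        unfolding 2 using n len by (subst Theta_last) auto
      show ?thesis
        unfolding eq using len
        by (cases ys rule: rev_cases) (auto simp: Vector_Spaces.linear_iff M.vector_space_axioms
          lm.add lm.scale add scale la.add la.scale scale_pair_def nth_append)
    next
      case 3
      then show ?thesis
        by (simp add: Theta_middle[simplified] Vector_Spaces.linear_iff M.vector_space_axioms)
    qed
  qed
  then show ?thesis
    by (auto simp: dend_cochains_def multilinear_maps_def Theta_def fun_eq_iff)
qed

lemma dend_differential_outside:
  assumes "length a \<noteq> Suc (Suc n) \<or> s = 0 \<or> s > Suc (Suc n)"
  shows "differential (dend_complex sM pr su) (Suc n) f s a = 0"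
proof -
  have "dend_comp (n + 1) (1 + 1) f i (dend_element pr su) s a = 0" if "i \<in> {1..n + 1}" for i
    using assms that by (auto simp: dend_comp_def)
  moreover have "dend_comp (1 + 1) (n + 1) (dend_element pr su) i f s a = 0" if "i \<in> {1..1 + 1}" for i
    using assms that by (auto simp: dend_comp_def)
  ultimately show ?thesis
    by (simp add: dend_complex_def dend_bracket_def del: sum.cl_ivl_Suc)
qed

lemma gRB_differential_outside:
  assumes "length u \<noteq> Suc n"
  shows "differential (gRB_complex sA sM l r R S) n F u = 0"
  using assms by (simp add: gRB_complex_def gRB_bracket_def)

lemma Theta_differential_apply_zero:
  assumes F: "F \<in> multilinear_maps sM (scale_pair sA) 0" and a: "length a = 2"
    and s: "s = 1 \<or> s = 2"
  shows "Theta sM l r 1 (differential (gRB_complex sA sM l r R S) 0 F) s a =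
    differential (dend_complex sM pr su) 1 (Theta sM l r 0 F) s a"
proof -
  obtain x y where a: "a = [x, y]"
    using a by (auto simp: numeral_2_eq_2 length_Suc_conv)
  obtain p q where pq: "F [] = (p, q)" by (cases "F []")
  let ?d = "differential (gRB_complex sA sM l r R S) 0 F"
  have d: "fst (?d [u]) = R (l p u) - R (r u q) + R u * p - p * R u"
    "snd (?d [u]) = S (l p u) - S (r u q) + S u * q - q * S u" for u
    by (subst gRB_differential[OF F]; force simp: pq)+
  have t: "Theta sM l r 0 F (Suc 0) [u] = l p u - r u q" for u
    by (simp add: Theta_def arg_def pq)
  note lin = la.add la.diff ra.add ra.diff lm.add lm.diff rm.add rm.diff R.diff S.diff
  from s show ?thesis
  proof
    assume s: "s = 1"
    have "Theta sM l r 1 ?d 1 a = r x (S (l p y) - S (r y q) + S y * q - q * S y)"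
      by (subst Theta_first) (simp_all add: a d)
    then show ?thesis
      using dend_differential[of a 0 1 "Theta sM l r 0 F"]
      by (simp add: s a dend_term_def contract_def t lin gRB_prec_def right_action actions_commute)
  next
    assume s: "s = 2"
    have "Theta sM l r 1 ?d 2 a = l (R (l p x) - R (r x q) + R x * p - p * R x) y"
      using Theta_last[of 1 a ?d] by (simp add: a d numeral_2_eq_2)
    then show ?thesis
      using dend_differential[of a 0 2 "Theta sM l r 0 F"]
      by (simp add: s a dend_term_def contract_def t lin gRB_succ_def left_action actions_commute
        numeral_2_eq_2)
  qed
qed

lemma Theta_differential_apply_first:
  assumes F: "F \<in> multilinear_maps sM (scale_pair sA) n" and n: "n \<ge> 1"
    and a: "length a = Suc (Suc n)"
  shows "Theta sM l r (Suc n) (differential (gRB_complex sA sM l r R S) n F) 1 a =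
    sM ((-1) ^ n) (differential (dend_complex sM pr su) (Suc n) (Theta sM l r n F) 1 a)"
proof -
  obtain x v where a: "a = x # v" and v: "length v = Suc n"
    using a by (auto simp: length_Suc_conv)
  let ?f = "Theta sM l r n F"
  have t0: "dend_term ?f 1 a 0 = sM ((-1) ^ (n + 1)) (r (r x (S (v ! 0))) (snd (F (drop 1 v))))"
    using v n by (simp add: dend_term_def a Theta_first[simplified] contract_def gRB_prec_def)
  have t1: "dend_term ?f 1 a (Suc i) = sM ((-1) ^ (n + 1)) (r x (snd (F (contract star i v))))"
    if "i < n" for i
    using that v n
    by (simp add: dend_term_def a contract_Suc_Cons Theta_first[simplified] length_contract)
  have sum: "(\<Sum>i<Suc n. sM ((-1) ^ i) (dend_term ?f 1 a i)) =
      sM ((-1) ^ (n + 1)) (r (r x (S (v ! 0))) (snd (F (drop 1 v))))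
      - sM ((-1) ^ (n + 1)) (\<Sum>i<n. sM ((-1) ^ i) (r x (snd (F (contract star i v)))))"
    unfolding sum.lessThan_Suc_shift t0
    by (simp add: t1 M.scale_sum_right sum_negf mult.commute del: One_nat_def)
  have f1: "?f 1 (take (Suc n) a) = sM ((-1) ^ (n + 1)) (r x (snd (F (take n v))))"
    using v n by (subst Theta_first) (auto simp: a)
  have fsum: "(\<Sum>t = 1..Suc n. ?f t (drop 1 a)) =
    sM ((-1) ^ (n + 1)) (r (v ! 0) (snd (F (drop 1 v)))) + l (fst (F (take n v))) (v ! n)"
    using v n by (subst Theta_sum) (auto simp: a)
  have "Theta sM l r (Suc n) (differential (gRB_complex sA sM l r R S) n F) 1 a =
      sM ((-1) ^ n) (r x (snd (differential (gRB_complex sA sM l r R S) n F v)))"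
    using v by (subst Theta_first) (auto simp: a)
  also have "\<dots> = sM ((-1) ^ n) (differential (dend_complex sM pr su) (Suc n) ?f 1 a)"
    using dend_differential[of a n 1 ?f] v
    unfolding sum f1 fsum gRB_differential[OF F v disjI2[OF conjI[OF refl refl]]]
    by (cases "even n")
      (simp_all add: a ra.add ra.diff ra.neg ra.sum ra.scale right_action rm.neg S.add S.neg S.diff)
  finally show ?thesis .
qed

lemma Theta_differential_apply_last:
  assumes F: "F \<in> multilinear_maps sM (scale_pair sA) n" and n: "n \<ge> 1"
    and a: "length a = Suc (Suc n)"
  shows "Theta sM l r (Suc n) (differential (gRB_complex sA sM l r R S) n F) (Suc (Suc n)) a =
    sM ((-1) ^ n)
      (differential (dend_complex sM pr su) (Suc n) (Theta sM l r n F) (Suc (Suc n)) a)"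
proof -
  obtain w z where a: "a = w @ [z]" and w: "length w = Suc n"
    using a by (cases a rule: rev_cases) auto
  have w0: "(w @ [z]) ! 0 = w ! 0" "(w @ [z]) ! n = w ! n" "(w @ [z]) ! Suc n = z"
    using w by (auto simp: nth_append)
  let ?f = "Theta sM l r n F"
  have t0: "dend_term ?f (Suc (Suc n)) a n = l (fst (F (take n w))) (l (R (w ! n)) z)"
    using w n by (simp add: dend_term_def a Theta_last contract_def gRB_succ_def w0 nth_append)
  have t1: "dend_term ?f (Suc (Suc n)) a i = l (fst (F (contract star i w))) z" if "i < n" for i
    using that w n
    by (simp add: dend_term_def a Theta_last contract_snoc length_contract nth_append)
  have sum: "(\<Sum>i<Suc n. sM ((-1) ^ i) (dend_term ?f (Suc (Suc n)) a i)) =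
      (\<Sum>i<n. sM ((-1) ^ i) (l (fst (F (contract star i w))) z))
      + sM ((-1) ^ n) (l (fst (F (take n w))) (l (R (w ! n)) z))"
    unfolding sum.lessThan_Suc t0 by (simp add: t1)
  have f1: "?f (Suc n) (drop 1 a) = l (fst (F (drop 1 w))) z"
    using w n by (subst Theta_last) (auto simp: a nth_append)
  have fsum: "(\<Sum>t = 1..Suc n. ?f t (take (Suc n) a)) =
    sM ((-1) ^ (n + 1)) (r (w ! 0) (snd (F (drop 1 w)))) + l (fst (F (take n w))) (w ! n)"
    using w n by (subst Theta_sum) (auto simp: a)
  have "Theta sM l r (Suc n) (differential (gRB_complex sA sM l r R S) n F) (Suc (Suc n)) a =
      l (fst (differential (gRB_complex sA sM l r R S) n F w)) z"
    using w by (subst Theta_last) (auto simp: a w0)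
  also have "\<dots> = sM ((-1) ^ n) (differential (dend_complex sM pr su) (Suc n) ?f (Suc (Suc n)) a)"
    using dend_differential[of a n "Suc (Suc n)" ?f] w f1
    unfolding sum fsum gRB_differential[OF F w disjI1[OF conjI[OF refl refl]]]
    by (cases "even n")
      (simp_all add: a w0 la.add la.diff la.neg la.sum la.scale left_action R.add R.neg R.diff)
  finally show ?thesis .
qed

lemma Theta_differential_apply_middle:
  assumes n: "n \<ge> 1" and a: "length a = Suc (Suc n)" and s: "1 < s" "s \<le> Suc n"
  shows "differential (dend_complex sM pr su) (Suc n) (Theta sM l r n F) s a = 0"
proof -
  let ?f = "Theta sM l r n F"
  define X where "X = (if s = 2
    then sM ((-1) ^ (n + 1)) (r (l (R (a ! 0)) (a ! 1)) (snd (F (drop 2 a)))) else 0)"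
  define Y where "Y = (if s = Suc n
    then l (fst (F (take n a))) (r (a ! n) (S (a ! Suc n))) else 0)"
  have dt: "dend_term ?f s a i = (if i = 0 then X else 0) + (if i = n then Y else 0)"
    if i: "i < Suc n" for i
  proof -
    consider "s \<le> i" | "s = Suc i" | "s = Suc (Suc i)" | "Suc (Suc i) < s" by linarith
    then show ?thesis
    proof cases
      case 1
      then show ?thesis using s i by (simp add: dend_term_def X_def Y_def Theta_middle)
    next
      case 2
      have "dend_term ?f s a i = ?f s (contract pr i a)" using 2 by (simp add: dend_term_def)
      also have "\<dots> = (if i = n then Y else 0)"
        using 2 a n s
        by (auto simp: Y_def Theta_last length_contract Theta_middle)
          (auto simp: contract_def gRB_prec_def nth_append)
      finally show ?thesis using 2 s by simp
    next
      case 3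
      have "dend_term ?f s a i = ?f (s - 1) (contract su i a)" using 3 by (simp add: dend_term_def)
      also have "\<dots> = (if i = 0 then X else 0)"
        using 3 a n s
        by (auto simp: X_def Theta_first[simplified] length_contract Theta_middle)
          (auto simp: contract_def gRB_succ_def numeral_2_eq_2)
      finally show ?thesis using 3 s by simp
    next
      case 4
      then show ?thesis using s i by (simp add: dend_term_def X_def Y_def Theta_middle)
    qed
  qed
  have "(\<Sum>i<Suc n. sM ((-1) ^ i) (dend_term ?f s a i)) =
      (\<Sum>i<Suc n. (if i = 0 then X else 0) + (if i = n then sM ((-1) ^ n) Y else 0))"
    by (rule sum.cong[OF refl]) (auto simp: dt M.scale_right_distrib)
  also have "\<dots> = X + sM ((-1) ^ n) Y"
    unfolding sum.distrib by (simp add: sum.delta' del: sum.lessThan_Suc)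
  finally have sum: "(\<Sum>i<Suc n. sM ((-1) ^ i) (dend_term ?f s a i)) = X + sM ((-1) ^ n) Y" .
  have b1: "r (?f s (take (Suc n) a)) (S (a ! Suc n)) = Y"
    using a n s by (auto simp: Y_def Theta_last Theta_middle actions_commute)
  have b2: "l (R (a ! 0)) (?f (s - 1) (drop 1 a)) = X"
  proof (cases "s = 2")
    case True
    then show ?thesis
      using a n Theta_first[of n "drop 1 a" F]
      by (simp add: X_def actions_commute lm.scale lm.neg numeral_2_eq_2)
  next
    case False
    then show ?thesis using s by (simp add: X_def Theta_middle)
  qed
  show ?thesis
    using dend_differential[of a n s ?f] a s unfolding sum b1 b2 by simp
qed

lemma Theta_differential:
  assumes F: "F \<in> multilinear_maps sM (scale_pair sA) n"
  shows "Theta sM l r (n + 1) (differential (gRB_complex sA sM l r R S) n F) =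
    (\<lambda>s a. sM ((-1) ^ n) (differential (dend_complex sM pr su) (n + 1) (Theta sM l r n F) s a))"
proof (intro ext)
  fix s :: nat and a :: "'m list"
  let ?d = "differential (gRB_complex sA sM l r R S) n F"
  consider "length a \<noteq> Suc (Suc n) \<or> s = 0 \<or> s > Suc (Suc n)"
    | "length a = Suc (Suc n)" "n = 0" "s = 1 \<or> s = 2"
    | "length a = Suc (Suc n)" "n \<ge> 1" "s = 1"
    | "length a = Suc (Suc n)" "n \<ge> 1" "s = Suc (Suc n)"
    | "length a = Suc (Suc n)" "n \<ge> 1" "1 < s" "s \<le> Suc n"
    by linarith
  then show "Theta sM l r (n + 1) ?d s a =
    sM ((-1) ^ n) (differential (dend_complex sM pr su) (n + 1) (Theta sM l r n F) s a)"
  proof cases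
    case 1
    then show ?thesis using dend_differential_outside[OF 1] by (auto simp: Theta_def)
  next
    case 2
    then show ?thesis using Theta_differential_apply_zero[of F a s] F by simp
  next
    case 3
    then show ?thesis using Theta_differential_apply_first[OF F] by simp
  next
    case 4
    then show ?thesis using Theta_differential_apply_last[OF F] by simp
  next
    case 5
    then show ?thesis
      using Theta_differential_apply_middle[of n a s F] by (simp add: Theta_middle)
  qed
qed

lemma linear_complex_gRB: "linear_complex (gRB_complex sA sM l r R S)"
proof -
  interpret P: vector_space "scale_pair sA"
    by (rule vector_space_scale_pair) (rule vector_space_axioms)
  let ?K = "gRB_complex sA sM l r R S"
  note simps = gRB_complex_def[THEN arg_cong[where f=scalar]]
    gRB_complex_def[THEN arg_cong[where f=cochains]]
  note sub = subspace_multilinear_maps[OF M.vector_space_axioms P.vector_space_axioms]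
  interpret V: vector_space "scalar ?K"
    by unfold_locales
      (auto simp: simps fun_eq_iff P.scale_right_distrib P.scale_left_distrib)
  note lin = la.add ra.add R.add S.add la.scale ra.scale R.scale S.scale
    scale_right_distrib scale_left_commute scale_mult_left[symmetric] scale_mult_right[symmetric] distrib_left distrib_right
    sum.distrib scale_sum_right scale_right_diff_distrib
  show ?thesis
  proof (intro linear_complex.intro V.vector_space_axioms linear_complex_axioms.intro)
    show "V.subspace (cochains ?K n)" for n
      unfolding V.subspace_def using sub by (simp add: simps)
  next
    fix F G :: "'m list \<Rightarrow> 'a \<times> 'a" and n
    assume "F \<in> cochains ?K n" "G \<in> cochains ?K n"
    then have F: "F \<in> multilinear_maps sM (scale_pair sA) n"
      and G: "G \<in> multilinear_maps sM (scale_pair sA) n" by (simp_all add: simps)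
    show "differential ?K n (F + G) = differential ?K n F + differential ?K n G"
    proof
      fix u
      show "differential ?K n (F + G) u = (differential ?K n F + differential ?K n G) u"
      proof (cases "length u = Suc n")
        case u: True
        note d = gRB_differential[OF _ u disjI1[OF conjI[OF refl refl]]]
          gRB_differential[OF _ u disjI2[OF conjI[OF refl refl]]]
        show ?thesis
          by (rule prod_eqI)
            (simp_all add: d[OF F] d[OF G] d[OF sub(2)[OF F G]] lin algebra_simps)
      qed (simp add: gRB_differential_outside)
    qed
  next
    fix F :: "'m list \<Rightarrow> 'a \<times> 'a" and c n
    assume "F \<in> cochains ?K n"
    then have F: "F \<in> multilinear_maps sM (scale_pair sA) n" by (simp add: simps)
    show "differential ?K n (scalar ?K c F) = scalar ?K c (differential ?K n F)"
    proof
      fix u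
      show "differential ?K n (scalar ?K c F) u = scalar ?K c (differential ?K n F) u"
      proof (cases "length u = Suc n")
        case u: True
        note d = gRB_differential[OF _ u disjI1[OF conjI[OF refl refl]]]
          gRB_differential[OF _ u disjI2[OF conjI[OF refl refl]]]
        have s: "fst (scale_pair sA c p) = sA c (fst p)" "snd (scale_pair sA c p) = sA c (snd p)"
          for p by (simp_all add: scale_pair_def)
        show ?thesis
          unfolding simps complex.select_convs
          by (rule prod_eqI)
            (simp_all only: s d[OF F] d[OF sub(3)[OF F]] lin)
      qed (simp add: simps gRB_differential_outside)
    qed
  qed
qed

lemma linear_complex_dend: "linear_complex (dend_complex sM pr su)"
proof -
  let ?L = "dend_complex sM pr su"
  note simps = dend_complex_def[THEN arg_cong[where f=scalar]]
    dend_complex_def[THEN arg_cong[where f=cochains]]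
  note sub = subspace_multilinear_maps[OF M.vector_space_axioms M.vector_space_axioms]
  interpret V: vector_space "scalar ?L"
    by unfold_locales
      (auto simp: simps fun_eq_iff M.scale_right_distrib M.scale_left_distrib)
  have term_add: "dend_term (f + g) s a i = dend_term f s a i + dend_term g s a i"
    and term_scale: "dend_term (\<lambda>s a. sM c (f s a)) s a i = sM c (dend_term f s a i)" for f g s a i c
    by (simp_all add: dend_term_def)
  note lin = lm.add rm.add R.add S.add lm.scale rm.scale R.scale S.scale la.add la.scale
    ra.add ra.scale term_add term_scale
    M.scale_right_distrib sum.distrib M.scale_sum_right M.scale_right_diff_distrib
    R.sum S.sum la.sum ra.sum mult.commute
  have add: "differential ?L (Suc n) (f + g) = differential ?L (Suc n) f + differential ?L (Suc n) g"
    and scale: "differential ?L (Suc n) (scalar ?L c f) = scalar ?L c (differential ?L (Suc n) f)"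
    for n f g c
  proof -
    have "differential ?L (Suc n) (f + g) s a = differential ?L (Suc n) f s a + differential ?L (Suc n) g s a
      \<and> differential ?L (Suc n) (scalar ?L c f) s a = sM c (differential ?L (Suc n) f s a)" for s a
    proof (cases "length a \<noteq> Suc (Suc n) \<or> s = 0 \<or> s > Suc (Suc n)")
      case True
      then show ?thesis by (simp only: dend_differential_outside) simp
    next
      case False
      then have "length a = Suc (Suc n)" "1 \<le> s" "s \<le> Suc (Suc n)" by auto
      note d = dend_differential[OF this]
      show ?thesis
        unfolding d simps complex.select_convs by (simp add: lin)
    qed
    then show "differential ?L (Suc n) (f + g) = differential ?L (Suc n) f + differential ?L (Suc n) g"
      and "differential ?L (Suc n) (scalar ?L c f) = scalar ?L c (differential ?L (Suc n) f)"
      by (simp_all add: fun_eq_iff simps)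
  qed
  \<comment> \<open>In degree 0, below the start of the complex, \<open>n - 1\<close> is truncated to 0.\<close>
  have degree_zero: "differential ?L 0 = differential ?L (Suc 0)"
    by (simp add: dend_complex_def)
  show ?thesis
  proof (intro linear_complex.intro V.vector_space_axioms linear_complex_axioms.intro)
    show "V.subspace (cochains ?L n)" for n
      unfolding V.subspace_def using sub by (simp add: simps dend_cochains_def zero_fun_def)
  next
    show "differential ?L n (f + g) = differential ?L n f + differential ?L n g" for n f g
      by (cases n) (simp_all only: degree_zero add)
    show "differential ?L n (scalar ?L c f) = scalar ?L c (differential ?L n f)" for n c f
      by (cases n) (simp_all only: degree_zero scale)
  qed
qed

end

theorem theorem3p7:
  fixes sA :: "'k::field_char_0 \<Rightarrow> 'a::ring \<Rightarrow> 'a"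
    and sM :: "'k \<Rightarrow> 'm::ab_group_add \<Rightarrow> 'm"
    and l :: "'a \<Rightarrow> 'm \<Rightarrow> 'm"
    and r :: "'m \<Rightarrow> 'a \<Rightarrow> 'm"
    and R S :: "'m \<Rightarrow> 'a"
  assumes "generalized_rota_baxter_system sA sM l r R S"
  defines "K \<equiv> gRB_complex sA sM l r R S"
    and "L \<equiv> dend_complex sM (gRB_prec r S) (gRB_succ l R)"
  shows "\<exists>T :: nat \<Rightarrow> ('m list \<Rightarrow> 'a \<times> 'a) set \<Rightarrow> (nat \<Rightarrow> 'm list \<Rightarrow> 'm) set.
    \<forall>n. linear_on_cohomology K n L (n + 1) (T n)
      \<and> (\<forall>F \<in> cocycles K n. Theta sM l r n F \<in> cocycles L (n + 1)
            \<and> T n (cohomology_class K n F) = cohomology_class L (n + 1) (Theta sM l r n F))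
      \<and> (\<forall>F \<in> coboundaries K n. Theta sM l r n F \<in> coboundaries L (n + 1))"
proof -
  interpret generalized_rota_baxter_system sA sM l r R S by fact
  have K: "linear_complex K" and L: "linear_complex L"
    unfolding K_def L_def by (rule linear_complex_gRB linear_complex_dend)+
  show ?thesis
  proof (rule induced_map_on_cohomology[OF K L])
    fix n f assume "f \<in> cochains K n"
    then have f: "f \<in> multilinear_maps sM (scale_pair sA) n"
      by (simp add: K_def gRB_complex_def)
    show "Theta sM l r n f \<in> cochains L (n + 1)"
      using Theta_cochain[OF f] by (simp add: L_def dend_complex_def)
    show "Theta sM l r (n + 1) (differential K n f) =
        scalar L ((-1) ^ n) (differential L (n + 1) (Theta sM l r n f))"
      using Theta_differential[OF f]
      by (simp add: K_def L_def dend_complex_def[THEN arg_cong[where f=scalar]])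
  next
    show "Theta sM l r n (scalar K c f) = scalar L c (Theta sM l r n f)" for n c f
      using Theta_scale by (simp add: K_def L_def gRB_complex_def dend_complex_def)
  qed (simp_all add: Theta_add K_def L_def gRB_complex_def dend_complex_def)
qed

end
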